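(* For any ring $R$, the radical-dualradical monoid of $R$ is a collapse (quotient, sending generators to generators) of the four-element monoid $\{1,r,d,d^2\}$ which is subject to the relations $r^2=r$, $d^3=d$, and $rd=d=dr$. In the largest such monoid (the one in which $1,r,d,d^2$ are all distinct), the partial order consists of the chain $1<r<d^2$ together with the element $d$, which is incomparable to each of $1$, $r$, $d^2$.
   Context: Rings have an identity and need not be commutative; "ideal" means two-sided ideal. A proper ideal $P$ is prime if for all ideals $I,J$, $IJ\subseteq P$ implies $I\subseteq P$ or $J\subseteq P$. For an ideal $I$ of $R$, $r(I)$ is the intersection of all prime ideals containing $I$ (with $r(R)=R$), and the dualradical $d(I)$ is the intersection of all prime ideals not containing $I$ (the empty intersection being $R$). Both are maps from the set of ideals of $R$ to itself; products denote composition and $1$ is the identity map. The radical-dualradical monoid of $R$ is the monoid of maps generated by $r$ and $d$ under composition, partially ordered by $f\le g$ iff $f(I)\subseteq g(I)$ for every ideal $I$. *)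

theory Defs
  imports "HOL-Algebra.Ideal_Product"
begin

section \<open>Prime ideals, radical and dualradical\<close>

text \<open>
  The library's \<^locale>\<open>primeideal\<close> extends \<^locale>\<open>cring\<close> and is elementwise, so it does not
  serve noncommutative rings. The ideals of \<^locale>\<open>ideal\<close> are two-sided.
\<close>

definition prime_ideal :: "'a set \<Rightarrow> ('a, 'b) ring_scheme \<Rightarrow> bool" where
  "prime_ideal P R \<longleftrightarrow> ideal P R \<and> P \<noteq> carrier R \<and>
     (\<forall>I J. ideal I R \<longrightarrow> ideal J R \<longrightarrow> I \<cdot>\<^bsub>R\<^esub> J \<subseteq> P \<longrightarrow> I \<subseteq> P \<or> J \<subseteq> P)"

text \<open>
  Maps on ideals are extensional functions, so that equality in HOL is equality of maps
  on the set of ideals. Intersecting with the carrier makes empty intersections equal to the ring.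
\<close>

definition rad :: "('a, 'b) ring_scheme \<Rightarrow> 'a set \<Rightarrow> 'a set" where
  "rad R = (\<lambda>I \<in> {I. ideal I R}. carrier R \<inter> \<Inter>{P. prime_ideal P R \<and> I \<subseteq> P})"

definition dualrad :: "('a, 'b) ring_scheme \<Rightarrow> 'a set \<Rightarrow> 'a set" where
  "dualrad R = (\<lambda>I \<in> {I. ideal I R}. carrier R \<inter> \<Inter>{P. prime_ideal P R \<and> \<not> I \<subseteq> P})"

lemma (in ring) ideal_carrier_Inter:
  assumes "\<And>P. P \<in> S \<Longrightarrow> ideal P R"
  shows "ideal (carrier R \<inter> \<Inter>S) R"
proof -
  have "ideal (\<Inter>(insert (carrier R) S)) R"
    using assms oneideal by (intro i_Intersect) auto
  then show ?thesis by simp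
qed

lemma (in ring) rad_funcset: "rad R \<in> {I. ideal I R} \<rightarrow>\<^sub>E {I. ideal I R}"
  unfolding rad_def by (auto intro!: ideal_carrier_Inter simp: prime_ideal_def)

lemma (in ring) dualrad_funcset: "dualrad R \<in> {I. ideal I R} \<rightarrow>\<^sub>E {I. ideal I R}"
  unfolding dualrad_def by (auto intro!: ideal_carrier_Inter simp: prime_ideal_def)


section \<open>The radical-dualradical monoid\<close>

definition map_monoid :: "'x set \<Rightarrow> ('x \<Rightarrow> 'x) monoid" where
  "map_monoid A = \<lparr>carrier = A \<rightarrow>\<^sub>E A, mult = compose A, one = (\<lambda>x \<in> A. x)\<rparr>"

definition rd_monoid :: "('a, 'b) ring_scheme \<Rightarrow> ('a set \<Rightarrow> 'a set) monoid" where
  "rd_monoid R = (let M = map_monoid {I. ideal I R} in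
     M\<lparr>carrier := \<Inter>{H. submonoid H M \<and> {rad R, dualrad R} \<subseteq> H}\<rparr>)"

lemma map_monoid_is_monoid: "monoid (map_monoid A)"
proof (rule monoidI)
  fix f g
  assume "f \<in> carrier (map_monoid A)" "g \<in> carrier (map_monoid A)"
  then show "f \<otimes>\<^bsub>map_monoid A\<^esub> g \<in> carrier (map_monoid A)"
    by (simp add: map_monoid_def PiE_iff Pi_iff compose_def)
next
  show "\<one>\<^bsub>map_monoid A\<^esub> \<in> carrier (map_monoid A)"
    by (simp add: map_monoid_def PiE_iff)
next
  fix f g h
  assume "f \<in> carrier (map_monoid A)" "g \<in> carrier (map_monoid A)" "h \<in> carrier (map_monoid A)"
  then show "f \<otimes>\<^bsub>map_monoid A\<^esub> g \<otimes>\<^bsub>map_monoid A\<^esub> h = f \<otimes>\<^bsub>map_monoid A\<^esub> (g \<otimes>\<^bsub>map_monoid A\<^esub> h)"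
    by (simp add: map_monoid_def compose_assoc[of h A A f g] PiE_iff Pi_iff)
next
  fix f
  assume "f \<in> carrier (map_monoid A)"
  then have f: "f \<in> A \<rightarrow> A" "f \<in> extensional A"
    by (simp_all add: map_monoid_def PiE_def)
  show "\<one>\<^bsub>map_monoid A\<^esub> \<otimes>\<^bsub>map_monoid A\<^esub> f = f"
    using Id_compose[OF f] by (simp add: map_monoid_def)
  show "f \<otimes>\<^bsub>map_monoid A\<^esub> \<one>\<^bsub>map_monoid A\<^esub> = f"
    using compose_Id[OF f] by (simp add: map_monoid_def)
qed

lemma (in ring) rd_monoid_is_monoid: "monoid (rd_monoid R)"
proof -
  let ?M = "map_monoid {I. ideal I R}"
  interpret M: monoid ?M by (rule map_monoid_is_monoid)
  have S: "submonoid (carrier ?M) ?M" by (simp add: submonoid_def)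
  have gens: "{rad R, dualrad R} \<subseteq> carrier ?M"
    using rad_funcset dualrad_funcset by (simp add: map_monoid_def)
  have "submonoid (\<Inter>{H. submonoid H ?M \<and> {rad R, dualrad R} \<subseteq> H}) ?M"
    using S gens by (auto simp: submonoid_def)
  then show ?thesis
    unfolding rd_monoid_def Let_def using M.monoid_axioms
    by (rule submonoid.submonoid_is_monoid)
qed

definition map_le :: "('a, 'b) ring_scheme \<Rightarrow> ('a set \<Rightarrow> 'a set) \<Rightarrow> ('a set \<Rightarrow> 'a set) \<Rightarrow> bool" where
  "map_le R f g \<longleftrightarrow> (\<forall>I. ideal I R \<longrightarrow> f I \<subseteq> g I)"

definition map_less :: "('a, 'b) ring_scheme \<Rightarrow> ('a set \<Rightarrow> 'a set) \<Rightarrow> ('a set \<Rightarrow> 'a set) \<Rightarrow> bool" where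
  "map_less R f g \<longleftrightarrow> map_le R f g \<and> f \<noteq> g"

definition map_incomparable ::
    "('a, 'b) ring_scheme \<Rightarrow> ('a set \<Rightarrow> 'a set) \<Rightarrow> ('a set \<Rightarrow> 'a set) \<Rightarrow> bool" where
  "map_incomparable R f g \<longleftrightarrow> \<not> map_le R f g \<and> \<not> map_le R g f"


section \<open>Monoids presented by generators and relations\<close>

inductive pres_cong :: "('g list \<times> 'g list) set \<Rightarrow> 'g list \<Rightarrow> 'g list \<Rightarrow> bool"
  for Rels :: "('g list \<times> 'g list) set" where
  rel: "(u, v) \<in> Rels \<Longrightarrow> pres_cong Rels u v"
| refl: "pres_cong Rels u u"
| sym: "pres_cong Rels u v \<Longrightarrow> pres_cong Rels v u"
| trans: "pres_cong Rels u v \<Longrightarrow> pres_cong Rels v w \<Longrightarrow> pres_cong Rels u w"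
| ctxt: "pres_cong Rels u v \<Longrightarrow> pres_cong Rels (x @ u @ y) (x @ v @ y)"

definition word_class :: "('g list \<times> 'g list) set \<Rightarrow> 'g list \<Rightarrow> 'g list set" where
  "word_class Rels u = {v. pres_cong Rels u v}"

definition presented_monoid :: "('g list \<times> 'g list) set \<Rightarrow> 'g list set monoid" where
  "presented_monoid Rels =
     \<lparr>carrier = range (word_class Rels),
      mult = (\<lambda>A B. \<Union>u\<in>A. \<Union>v\<in>B. word_class Rels (u @ v)),
      one = word_class Rels []\<rparr>"

lemma word_class_eq_iff: "word_class Rels u = word_class Rels v \<longleftrightarrow> pres_cong Rels u v"
proof
  assume "word_class Rels u = word_class Rels v"
  moreover have "v \<in> word_class Rels v" by (simp add: word_class_def pres_cong.refl)
  ultimately have "v \<in> word_class Rels u" by simp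
  then show "pres_cong Rels u v" by (simp add: word_class_def)
next
  assume "pres_cong Rels u v"
  then show "word_class Rels u = word_class Rels v"
    unfolding word_class_def set_eq_iff mem_Collect_eq by (meson pres_cong.trans pres_cong.sym)
qed

lemma pres_cong_append:
  assumes "pres_cong Rels u u'" "pres_cong Rels v v'"
  shows "pres_cong Rels (u @ v) (u' @ v')"
proof (rule pres_cong.trans)
  show "pres_cong Rels (u @ v) (u' @ v)"
    using pres_cong.ctxt[OF assms(1), of "[]" v] by simp
  show "pres_cong Rels (u' @ v) (u' @ v')"
    using pres_cong.ctxt[OF assms(2), of u' "[]"] by simp
qed

lemma presented_mult:
  "word_class Rels u \<otimes>\<^bsub>presented_monoid Rels\<^esub> word_class Rels v = word_class Rels (u @ v)"
proof -
  have eq: "word_class Rels (u' @ v') = word_class Rels (u @ v)"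
    if "u' \<in> word_class Rels u" "v' \<in> word_class Rels v" for u' v'
  proof -
    have "pres_cong Rels u u'" "pres_cong Rels v v'"
      using that by (simp_all add: word_class_def)
    from pres_cong_append[OF this] show ?thesis
      by (simp add: word_class_eq_iff pres_cong.sym)
  qed
  have ne: "u \<in> word_class Rels u" "v \<in> word_class Rels v"
    by (simp_all add: word_class_def pres_cong.refl)
  have "(\<Union>u'\<in>word_class Rels u. \<Union>v'\<in>word_class Rels v. word_class Rels (u' @ v'))
      = (\<Union>u'\<in>word_class Rels u. \<Union>v'\<in>word_class Rels v. word_class Rels (u @ v))"
    by (intro SUP_cong HOL.refl eq)
  also have "\<dots> = word_class Rels (u @ v)"
    using ne by blast
  finally show ?thesis
    by (simp add: presented_monoid_def)
qed

lemma presented_monoid_is_monoid: "monoid (presented_monoid Rels)"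
proof -
  have c: "carrier (presented_monoid Rels) = range (word_class Rels)"
    and o: "\<one>\<^bsub>presented_monoid Rels\<^esub> = word_class Rels []"
    by (simp_all add: presented_monoid_def)
  show ?thesis
    by (rule monoidI) (auto simp: c o presented_mult)
qed

datatype rd_gen = Rad | Dual

definition rd_relations :: "(rd_gen list \<times> rd_gen list) set" where
  "rd_relations = {([Rad, Rad], [Rad]),
                   ([Dual, Dual, Dual], [Dual]),
                   ([Rad, Dual], [Dual]),
                   ([Dual, Rad], [Dual])}"

abbreviation rd_presented :: "rd_gen list set monoid" where
  "rd_presented \<equiv> presented_monoid rd_relations"

abbreviation rad_gen :: "rd_gen list set" where
  "rad_gen \<equiv> word_class rd_relations [Rad]"

abbreviation dual_gen :: "rd_gen list set" where
  "dual_gen \<equiv> word_class rd_relations [Dual]"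

end

theory Submission
  imports Defs "HOL-Algebra.IntRing"
begin

text \<open>
  Sending \<open>I\<close> to the intersection of the primes not containing it is antitone, and a prime not
  containing \<open>d I\<close> contains \<open>I\<close>; so \<open>(d, d)\<close> is an antitone Galois connection, whence \<open>d\<^sup>3 = d\<close>
  and \<open>1 \<le> d\<^sup>2\<close>. Values of \<open>d\<close> are intersections of primes and \<open>d\<close> sees only which primes
  contain \<open>I\<close>, whence \<open>rd = d = dr\<close> and \<open>r \<le> rd\<^sup>2 = d\<^sup>2\<close>. Any comparison of \<open>d\<close> with another
  element gives \<open>1 \<le> d\<close> or \<open>d \<le> d\<^sup>2\<close>; evaluated at the ring or at zero, either says that
  there are no primes, and then \<open>r = d\<close>. Over the integers the four maps are distinct:
  \<open>r(4) = (2)\<close>, while \<open>r(2) = (2)\<close>, \<open>d(2) = 0\<close> and \<open>d\<^sup>2(2) = d(0)\<close> is the whole ring.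
\<close>

section \<open>Evaluation of words in a monoid\<close>

text \<open>For \<open>\<phi>\<close> into the carrier of a monoid, this is the homomorphism from
  the free monoid of lists that extends \<open>\<phi>\<close>.\<close>

definition word_eval :: "('m, 'c) monoid_scheme \<Rightarrow> ('g \<Rightarrow> 'm) \<Rightarrow> 'g list \<Rightarrow> 'm" where
  "word_eval M \<phi> w = foldr (\<lambda>g x. \<phi> g \<otimes>\<^bsub>M\<^esub> x) w \<one>\<^bsub>M\<^esub>"

lemma word_eval_Nil [simp]: "word_eval M \<phi> [] = \<one>\<^bsub>M\<^esub>"
  and word_eval_Cons [simp]: "word_eval M \<phi> (g # w) = \<phi> g \<otimes>\<^bsub>M\<^esub> word_eval M \<phi> w"
  by (simp_all add: word_eval_def)

context monoid
begin

lemma word_eval_closed: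
  assumes "range \<phi> \<subseteq> carrier G"
  shows "word_eval G \<phi> w \<in> carrier G"
  using assms by (induction w) auto

lemma word_eval_append:
  assumes "range \<phi> \<subseteq> carrier G"
  shows "word_eval G \<phi> (u @ v) = word_eval G \<phi> u \<otimes> word_eval G \<phi> v"
proof (induction u)
  case Nil
  show ?case using word_eval_closed[OF assms] by simp
next
  case (Cons g u)
  have "\<phi> g \<in> carrier G" using assms by auto
  with Cons show ?case by (simp add: m_assoc word_eval_closed[OF assms])
qed

text \<open>Having equal values is a congruence on words, and \<open>pres_cong Rels\<close> is the
  least congruence containing \<open>Rels\<close>.\<close>

lemma word_eval_pres_cong:
  assumes \<phi>: "range \<phi> \<subseteq> carrier G"
    and rels: "\<And>u v. (u, v) \<in> Rels \<Longrightarrow> word_eval G \<phi> u = word_eval G \<phi> v"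
    and "pres_cong Rels u v"
  shows "word_eval G \<phi> u = word_eval G \<phi> v"
  using assms(3) by induction (simp_all add: rels word_eval_append[OF \<phi>])

text \<open>Universal property of the presentation: evaluation of words factors through the
  classes.\<close>

lemma presented_monoid_hom:
  assumes \<phi>: "range \<phi> \<subseteq> carrier G"
    and rels: "\<And>u v. (u, v) \<in> Rels \<Longrightarrow> word_eval G \<phi> u = word_eval G \<phi> v"
  obtains h where "h \<in> hom (presented_monoid Rels) G"
    and "\<And>w. h (word_class Rels w) = word_eval G \<phi> w"
proof
  \<comment> \<open>The chosen representative is immaterial, since congruent words have equal
    values.\<close>
  define h where "h = (\<lambda>A. word_eval G \<phi> (SOME u. u \<in> A))"
  show h: "h (word_class Rels w) = word_eval G \<phi> w" for w
  proof -
    have "w \<in> word_class Rels w" by (simp add: word_class_def pres_cong.refl)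
    then have "pres_cong Rels w (SOME u. u \<in> word_class Rels w)"
      by (metis mem_Collect_eq someI word_class_def)
    then show ?thesis
      by (simp add: h_def word_eval_pres_cong[OF \<phi> rels])
  qed
  show "h \<in> hom (presented_monoid Rels) G"
  proof (rule homI)
    have "carrier (presented_monoid Rels) = range (word_class Rels)"
      by (simp add: presented_monoid_def)
    then show "h x \<in> carrier G" "h (x \<otimes>\<^bsub>presented_monoid Rels\<^esub> y) = h x \<otimes> h y"
      if "x \<in> carrier (presented_monoid Rels)" "y \<in> carrier (presented_monoid Rels)" for x y
      using that by (auto simp: presented_mult h word_eval_append[OF \<phi>] word_eval_closed[OF \<phi>])
  qed
qed

lemma submonoid_range_word_eval:
  assumes \<phi>: "range \<phi> \<subseteq> carrier G"
  shows "submonoid (range (word_eval G \<phi>)) G"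
proof
  show "range (word_eval G \<phi>) \<subseteq> carrier G" using word_eval_closed[OF \<phi>] by blast
  show "\<one> \<in> range (word_eval G \<phi>)" by (metis rangeI word_eval_Nil)
  fix x y assume "x \<in> range (word_eval G \<phi>)" "y \<in> range (word_eval G \<phi>)"
  then show "x \<otimes> y \<in> range (word_eval G \<phi>)"
    by (auto simp flip: word_eval_append[OF \<phi>])
qed

end

section \<open>The four-element presented monoid\<close>

text \<open>An invariant of words that separates the four normal forms.\<close>

lemma rd_pres_cong_invariant:
  assumes "pres_cong rd_relations u v"
  shows "(u = [] \<longleftrightarrow> v = []) \<and> (Dual \<in> set u \<longleftrightarrow> Dual \<in> set v) \<and>
    (even (count_list u Dual) \<longleftrightarrow> even (count_list v Dual))"
  using assms by induction (auto simp: rd_relations_def)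

text \<open>A letter put before a normal form gives a normal form or a word that one relation
  shortens to one; in \<open>[Rad, Dual, Dual]\<close> the relation acts on a prefix.\<close>

lemma rd_normal_form:
  "\<exists>n \<in> {[], [Rad], [Dual], [Dual, Dual]}. pres_cong rd_relations w n"
proof (induction w)
  case Nil
  show ?case by (auto intro: pres_cong.refl)
next
  case (Cons g w)
  then obtain n where n: "n \<in> {[], [Rad], [Dual], [Dual, Dual]}" "pres_cong rd_relations w n"
    by blast
  have step: "pres_cong rd_relations (g # w) (g # n)"
    using pres_cong.ctxt[OF n(2), of "[g]" "[]"] by simp
  have "pres_cong rd_relations [Rad, Rad] [Rad]" "pres_cong rd_relations [Rad, Dual] [Dual]"
    "pres_cong rd_relations [Dual, Rad] [Dual]"
    "pres_cong rd_relations [Dual, Dual, Dual] [Dual]"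
    by (auto intro!: pres_cong.rel simp: rd_relations_def)
  moreover from this(2) have "pres_cong rd_relations [Rad, Dual, Dual] [Dual, Dual]"
    using pres_cong.ctxt[of rd_relations "[Rad, Dual]" "[Dual]" "[]" "[Dual]"] by simp
  ultimately have "\<exists>m \<in> {[], [Rad], [Dual], [Dual, Dual]}. pres_cong rd_relations (g # n) m"
    using n(1) pres_cong.refl by (cases g) fastforce+
  with step show ?case by (blast intro: pres_cong.trans)
qed

lemma dual_gen_squared:
  "dual_gen [^]\<^bsub>rd_presented\<^esub> (2::nat) = word_class rd_relations [Dual, Dual]"
proof -
  have "\<one>\<^bsub>rd_presented\<^esub> = word_class rd_relations []" by (simp add: presented_monoid_def)
  then show ?thesis by (simp add: numeral_2_eq_2 presented_mult)
qed

lemma carrier_rd_presented: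
  "carrier rd_presented =
    {\<one>\<^bsub>rd_presented\<^esub>, rad_gen, dual_gen, dual_gen [^]\<^bsub>rd_presented\<^esub> (2::nat)}"
proof -
  have "word_class rd_relations w
      \<in> word_class rd_relations ` {[], [Rad], [Dual], [Dual, Dual]}" for w
    using rd_normal_form[of w] by (metis imageI word_class_eq_iff)
  then have "range (word_class rd_relations)
      = word_class rd_relations ` {[], [Rad], [Dual], [Dual, Dual]}"
    by blast
  then show ?thesis
    unfolding dual_gen_squared by (simp add: presented_monoid_def)
qed

lemma distinct_rd_presented:
  "distinct [\<one>\<^bsub>rd_presented\<^esub>, rad_gen, dual_gen, dual_gen [^]\<^bsub>rd_presented\<^esub> (2::nat)]"
  unfolding dual_gen_squared
  by (auto simp: presented_monoid_def word_class_eq_iff dest: rd_pres_cong_invariant)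

section \<open>Radical and dualradical\<close>

lemma rad_apply: "ideal I R \<Longrightarrow> rad R I = carrier R \<inter> \<Inter>{P. prime_ideal P R \<and> I \<subseteq> P}"
  by (simp add: rad_def)

lemma dualrad_apply:
  "ideal I R \<Longrightarrow> dualrad R I = carrier R \<inter> \<Inter>{P. prime_ideal P R \<and> \<not> I \<subseteq> P}"
  by (simp add: dualrad_def)

context ring
begin

lemma ideal_rad [intro]: "ideal I R \<Longrightarrow> ideal (rad R I) R"
  using rad_funcset by (auto simp: PiE_iff)

lemma ideal_dualrad [intro]: "ideal I R \<Longrightarrow> ideal (dualrad R I) R"
  using dualrad_funcset by (auto simp: PiE_iff)

lemma subset_rad: "ideal I R \<Longrightarrow> I \<subseteq> rad R I"
  using ideal.Icarr by (fastforce simp: rad_apply)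

text \<open>\<open>P\<close> is itself among the primes intersected if it contains \<open>I\<close>.
  Hence \<open>rad\<close> and \<open>dualrad\<close> cannot tell \<open>I\<close> from
  \<open>rad R I\<close>.\<close>

lemma rad_subset_prime_iff:
  "ideal I R \<Longrightarrow> prime_ideal P R \<Longrightarrow> rad R I \<subseteq> P \<longleftrightarrow> I \<subseteq> P"
  by (rule iffI, drule subset_rad) (auto simp: rad_apply)

lemma rad_mono: "ideal I R \<Longrightarrow> ideal J R \<Longrightarrow> I \<subseteq> J \<Longrightarrow> rad R I \<subseteq> rad R J"
  by (auto simp: rad_apply)

lemma dualrad_antimono: "ideal I R \<Longrightarrow> ideal J R \<Longrightarrow> I \<subseteq> J \<Longrightarrow> dualrad R J \<subseteq> dualrad R I"
  by (auto simp: dualrad_apply)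

lemma dualrad_subset_prime:
  "ideal I R \<Longrightarrow> prime_ideal P R \<Longrightarrow> \<not> I \<subseteq> P \<Longrightarrow> dualrad R I \<subseteq> P"
  by (auto simp: dualrad_apply)

lemma subset_dualrad_dualrad:
  assumes "ideal I R"
  shows "I \<subseteq> dualrad R (dualrad R I)"
proof
  fix x assume "x \<in> I"
  moreover have "x \<in> carrier R" using assms \<open>x \<in> I\<close> by (rule ideal.Icarr)
  ultimately show "x \<in> dualrad R (dualrad R I)"
    using dualrad_subset_prime[OF assms] ideal_dualrad[OF assms] by (auto simp: dualrad_apply)
qed

lemma rad_rad: "ideal I R \<Longrightarrow> rad R (rad R I) = rad R I"
  \<comment> \<open>\<open>conj_cong\<close> supplies the primality of \<open>P\<close> under which
    \<open>rad R I \<subseteq> P\<close> rewrites to \<open>I \<subseteq> P\<close>.\<close>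
  by (simp add: rad_apply[OF ideal_rad] rad_subset_prime_iff cong: conj_cong)
     (simp add: rad_apply)

lemma dualrad_rad: "ideal I R \<Longrightarrow> dualrad R (rad R I) = dualrad R I"
  by (simp add: dualrad_apply ideal_rad rad_subset_prime_iff cong: conj_cong)

text \<open>\<open>dualrad R I\<close> is an intersection of primes, and a prime containing an ideal
  contains its radical.\<close>

lemma rad_dualrad:
  assumes "ideal I R"
  shows "rad R (dualrad R I) = dualrad R I"
proof
  show "dualrad R I \<subseteq> rad R (dualrad R I)"
    using assms by (intro subset_rad ideal_dualrad)
  have "rad R (dualrad R I) \<subseteq> P" if "prime_ideal P R" "\<not> I \<subseteq> P" for P
    using that assms by (simp add: rad_subset_prime_iff ideal_dualrad dualrad_subset_prime)
  moreover have "rad R (dualrad R I) \<subseteq> carrier R"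
    using assms ideal_dualrad by (auto simp: rad_apply)
  ultimately show "rad R (dualrad R I) \<subseteq> dualrad R I"
    unfolding dualrad_apply[OF assms] by blast
qed

text \<open>One inclusion is \<open>subset_dualrad_dualrad\<close> at \<open>dualrad R I\<close>;
  the other is the antitone image of its instance at \<open>I\<close>.\<close>

lemma dualrad_dualrad_dualrad:
  assumes "ideal I R"
  shows "dualrad R (dualrad R (dualrad R I)) = dualrad R I"
  using assms by (intro equalityI dualrad_antimono subset_dualrad_dualrad ideal_dualrad)

lemma rad_subset_dualrad_dualrad:
  assumes "ideal I R"
  shows "rad R I \<subseteq> dualrad R (dualrad R I)"
  using rad_mono[OF assms _ subset_dualrad_dualrad[OF assms]] assms
  by (simp add: ideal_dualrad rad_dualrad)

text \<open>Every prime contains zero, so no prime enters the intersection.\<close>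

lemma dualrad_zero: "dualrad R {\<zero>} = carrier R"
proof -
  have "\<zero> \<in> P" if "prime_ideal P R" for P
    using that by (auto simp: prime_ideal_def intro: additive_subgroup.zero_closed ideal.axioms)
  then show ?thesis by (auto simp: dualrad_apply[OF zeroideal])
qed

text \<open>A prime would contain \<open>d R\<close>, the intersection of all primes, hence all of \<open>R\<close>.\<close>

lemma rad_eq_dualrad_if_dualrad_carrier:
  assumes "carrier R \<subseteq> dualrad R (carrier R)"
  shows "rad R = dualrad R"
proof -
  have "\<not> prime_ideal P R" for P
  proof
    assume P: "prime_ideal P R"
    then have "P \<subseteq> carrier R" "P \<noteq> carrier R"
      using ideal.Icarr by (fastforce simp: prime_ideal_def)+
    then show False
      using assms P dualrad_subset_prime[OF oneideal P] by blast
  qed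
  then show ?thesis by (simp add: rad_def dualrad_def)
qed

section \<open>The monoid generated by the two operators\<close>

lemma mult_rd_monoid: "x \<otimes>\<^bsub>rd_monoid R\<^esub> y = compose {I. ideal I R} x y"
  and one_rd_monoid: "\<one>\<^bsub>rd_monoid R\<^esub> = (\<lambda>I \<in> {I. ideal I R}. I)"
  by (simp_all add: rd_monoid_def map_monoid_def Let_def)

lemma dualrad_squared:
  "dualrad R [^]\<^bsub>rd_monoid R\<^esub> (2::nat) = (\<lambda>I \<in> {I. ideal I R}. dualrad R (dualrad R I))"
  using ideal_dualrad
  by (auto simp: numeral_2_eq_2 mult_rd_monoid one_rd_monoid compose_def fun_eq_iff)

lemma gens_in_rd_monoid: "{rad R, dualrad R} \<subseteq> carrier (rd_monoid R)"
  by (auto simp: rd_monoid_def Let_def)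

text \<open>Minimality among the submonoids of \<open>rd_monoid R\<close>: they are also submonoids
  of the monoid of all maps on ideals, over which the defining intersection runs.\<close>

lemma carrier_rd_monoid_subset:
  assumes "submonoid H (rd_monoid R)" "{rad R, dualrad R} \<subseteq> H"
  shows "carrier (rd_monoid R) \<subseteq> H"
proof -
  let ?M = "map_monoid {I. ideal I R}"
  interpret M: monoid ?M by (rule map_monoid_is_monoid)
  have "submonoid (carrier ?M) ?M" by (simp add: submonoid_def)
  moreover have "{rad R, dualrad R} \<subseteq> carrier ?M"
    using rad_funcset dualrad_funcset by (simp add: map_monoid_def)
  ultimately have "carrier (rd_monoid R) \<subseteq> carrier ?M"
    unfolding rd_monoid_def Let_def by auto
  with assms(1) have "submonoid H ?M"
    by (auto simp: submonoid_def rd_monoid_def Let_def)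
  with assms(2) show ?thesis
    by (auto simp: rd_monoid_def Let_def)
qed

lemma rd_presented_epi:
  obtains h where "h \<in> epi rd_presented (rd_monoid R)"
    and "h \<one>\<^bsub>rd_presented\<^esub> = \<one>\<^bsub>rd_monoid R\<^esub>" and "h rad_gen = rad R" and "h dual_gen = dualrad R"
proof -
  let ?M = "rd_monoid R"
  interpret M: monoid ?M by (rule rd_monoid_is_monoid)
  define \<phi> where "\<phi> = case_rd_gen (rad R) (dualrad R)"
  have [simp]: "\<phi> Rad = rad R" "\<phi> Dual = dualrad R" by (simp_all add: \<phi>_def)
  have \<phi>: "range \<phi> \<subseteq> carrier ?M"
    using gens_in_rd_monoid by (auto simp: \<phi>_def split: rd_gen.splits)
  have gens: "rad R \<in> carrier ?M" "dualrad R \<in> carrier ?M"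
    using gens_in_rd_monoid by auto
  \<comment> \<open>Extensional maps are equal once they agree on ideals, so each relation becomes
    an identity between values.\<close>
  have ext: "compose {I. ideal I R} f g = k"
    if "k \<in> extensional {I. ideal I R}" "\<And>I. ideal I R \<Longrightarrow> f (g I) = k I" for f g k
    using that by (auto simp: compose_def fun_eq_iff extensional_def)
  have extens: "rad R \<in> extensional {I. ideal I R}" "dualrad R \<in> extensional {I. ideal I R}"
    by (simp_all add: rad_def dualrad_def)
  have rels: "word_eval ?M \<phi> u = word_eval ?M \<phi> v" if "(u, v) \<in> rd_relations" for u v
    using that gens
    by (auto simp: rd_relations_def mult_rd_monoid[of "rad R"] mult_rd_monoid[of "dualrad R"]
      compose_eq rad_rad rad_dualrad dualrad_rad dualrad_dualrad_dualrad ideal_dualrad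
      one_rd_monoid intro!: ext extens)
  obtain h where h: "h \<in> hom rd_presented ?M"
    and hw: "\<And>w. h (word_class rd_relations w) = word_eval ?M \<phi> w"
    using M.presented_monoid_hom[OF \<phi> rels] by blast
  \<comment> \<open>A one-letter word evaluates to its generator, so the values of words form a
    submonoid containing both generators; this gives surjectivity.\<close>
  have "\<phi> g \<in> range (word_eval ?M \<phi>)" for g
    using \<phi> by (intro range_eqI[of _ _ "[g]"]) (auto simp: image_subset_iff)
  from this[of Rad] this[of Dual] have "{rad R, dualrad R} \<subseteq> range (word_eval ?M \<phi>)" by simp
  then have "carrier ?M = range (word_eval ?M \<phi>)"
    using carrier_rd_monoid_subset[OF M.submonoid_range_word_eval[OF \<phi>]] M.word_eval_closed[OF \<phi>]
    by blast
  also have "\<dots> = h ` carrier rd_presented"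
    by (simp add: presented_monoid_def image_image hw)
  finally have "h \<in> epi rd_presented ?M"
    using h by (simp add: epi_def)
  moreover have "h \<one>\<^bsub>rd_presented\<^esub> = \<one>\<^bsub>?M\<^esub>"
    by (simp add: presented_monoid_def hw)
  ultimately show ?thesis
    using that hw[of "[Rad]"] hw[of "[Dual]"] gens by simp
qed

lemma map_le_chain:
  "map_le R \<one>\<^bsub>rd_monoid R\<^esub> (rad R)"
  "map_le R (rad R) (dualrad R [^]\<^bsub>rd_monoid R\<^esub> (2::nat))"
  by (simp_all add: map_le_def one_rd_monoid dualrad_squared subset_rad rad_subset_dualrad_dualrad)

lemma map_le_trans: "map_le R f g \<Longrightarrow> map_le R g h \<Longrightarrow> map_le R f h"
  unfolding map_le_def by blast

text \<open>The bounds on \<open>f\<close> treat 1, \<open>rad R\<close> and the square of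
  \<open>dualrad R\<close> at once: either comparison passes to an end of the chain.\<close>

lemma dualrad_incomparable:
  assumes "rad R \<noteq> dualrad R"
    and f: "map_le R \<one>\<^bsub>rd_monoid R\<^esub> f" "map_le R f (dualrad R [^]\<^bsub>rd_monoid R\<^esub> (2::nat))"
  shows "map_incomparable R (dualrad R) f"
  unfolding map_incomparable_def
proof (intro conjI notI)
  assume "map_le R (dualrad R) f"
  then have "map_le R (dualrad R) (dualrad R [^]\<^bsub>rd_monoid R\<^esub> (2::nat))"
    using f(2) by (rule map_le_trans)
  \<comment> \<open>As \<open>dualrad R {\<zero>}\<close> is the whole ring, this reads
    \<open>carrier R \<subseteq> dualrad R (carrier R)\<close>.\<close>
  then have "dualrad R {\<zero>} \<subseteq> dualrad R (dualrad R {\<zero>})"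
    using zeroideal by (simp add: map_le_def dualrad_squared)
  then show False
    using assms(1) rad_eq_dualrad_if_dualrad_carrier by (simp add: dualrad_zero)
next
  assume "map_le R f (dualrad R)"
  with f(1) have "map_le R \<one>\<^bsub>rd_monoid R\<^esub> (dualrad R)" by (rule map_le_trans)
  then have "carrier R \<subseteq> dualrad R (carrier R)"
    using oneideal by (simp add: map_le_def one_rd_monoid)
  then show False
    using assms(1) rad_eq_dualrad_if_dualrad_carrier by simp
qed

end

section \<open>The integers\<close>

text \<open>Makes the elementwise primes of commutative rings available: if neither factor lies in
  \<open>I\<close>, two elements outside \<open>I\<close> have their product in
  \<open>I\<close>.\<close>

lemma (in primeideal) prime_ideal: "prime_ideal I R"
  unfolding prime_ideal_def
proof (intro conjI allI impI)
  show "ideal I R" by (rule is_ideal)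
  show "I \<noteq> carrier R" using I_notcarr by simp
  fix A B assume A: "ideal A R" and B: "ideal B R" and AB: "A \<cdot> B \<subseteq> I"
  show "A \<subseteq> I \<or> B \<subseteq> I"
  proof (rule ccontr)
    assume "\<not> (A \<subseteq> I \<or> B \<subseteq> I)"
    then obtain a b where ab: "a \<in> A" "b \<in> B" "a \<notin> I" "b \<notin> I" by blast
    then have "a \<otimes> b \<in> I" using AB by (blast intro: ideal_prod.prod)
    moreover have "a \<in> carrier R" "b \<in> carrier R"
      using ideal.Icarr[OF A] ideal.Icarr[OF B] ab by simp_all
    ultimately show False using I_prime ab by blast
  qed
qed

lemma int_prime_ideal_zero: "prime_ideal {0} \<Z>"
proof -
  have "primeideal {0} \<Z>"
    using int.zeroprimeideal by simp
  then show ?thesis by (rule primeideal.prime_ideal)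
qed

text \<open>The zero ideal is prime, hence one of the ideals intersected.\<close>

lemma int_dualrad_nonzero:
  assumes "ideal I \<Z>" "\<not> I \<subseteq> {0}"
  shows "dualrad \<Z> I = {0}"
proof
  show "dualrad \<Z> I \<subseteq> {0}"
    using int.dualrad_subset_prime[OF assms(1) int_prime_ideal_zero assms(2)] .
  show "{0} \<subseteq> dualrad \<Z> I"
    using int.ideal_dualrad[OF assms(1)] additive_subgroup.zero_closed ideal.axioms(1) by fastforce
qed

lemma int_dualrad_zero: "dualrad \<Z> {0} = UNIV"
  using int.dualrad_zero by simp

lemma int_rd_monoid_distinct:
  "distinct [\<one>\<^bsub>rd_monoid \<Z>\<^esub>, rad \<Z>, dualrad \<Z>, dualrad \<Z> [^]\<^bsub>rd_monoid \<Z>\<^esub> (2::nat)]"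
proof -
  let ?I = "\<lambda>n. Idl\<^bsub>\<Z>\<^esub> {n::int}"
  have id: "ideal (?I n) \<Z>" for n by (rule int.genideal_ideal) simp
  have mem: "m \<in> ?I n \<longleftrightarrow> n dvd m" for m n
    by (auto simp: int_Idl dvd_def mult.commute)
  have P2: "prime_ideal (?I 2) \<Z>"
    by (intro primeideal.prime_ideal prime_primeideal) simp
  have d: "dualrad \<Z> (?I n) = {0}" if "n \<noteq> 0" for n
    using that mem[of n n] by (intro int_dualrad_nonzero id) auto
  have r2: "rad \<Z> (?I 2) = ?I 2"
    using int.subset_rad[OF id] int.rad_subset_prime_iff[OF id P2] by blast
  \<comment> \<open>The square of \<open>?I 2\<close> lies in \<open>?I 4\<close>, so a prime
    containing \<open>?I 4\<close> contains \<open>?I 2\<close>.\<close>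
  have "2 \<in> P" if "prime_ideal P \<Z>" "?I 4 \<subseteq> P" for P
  proof -
    have "?I 2 \<cdot>\<^bsub>\<Z>\<^esub> ?I 2 \<subseteq> ?I 4"
    proof
      fix x assume "x \<in> ?I 2 \<cdot>\<^bsub>\<Z>\<^esub> ?I 2"
      then show "x \<in> ?I 4"
      proof induction
        case (prod i j)
        then have "2 * 2 dvd i * j" unfolding mem by (rule mult_dvd_mono)
        then show ?case by (simp add: mem)
      next
        case (sum s t)
        then show ?case by (simp add: mem)
      qed
    qed
    then have "?I 2 \<subseteq> P"
      using that id unfolding prime_ideal_def by (meson subset_trans)
    moreover have "2 \<in> ?I 2" by (simp add: mem)
    ultimately show ?thesis by blast
  qed
  then have r4: "2 \<in> rad \<Z> (?I 4)" by (auto simp: rad_apply[OF id])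
  have "1 \<notin> ?I 2" "2 \<in> ?I 2" "2 \<notin> ?I 4" by (simp_all add: mem)
  then have neq: "?I 2 \<noteq> UNIV" "?I 2 \<noteq> {0}" "rad \<Z> (?I 4) \<noteq> ?I 4"
    using r4 by (metis UNIV_I, metis singletonD zero_neq_numeral, metis)
  \<comment> \<open>At \<open>?I 2\<close> the four maps take the values \<open>?I 2\<close>,
    \<open>?I 2\<close>, \<open>{0}\<close> and \<open>UNIV\<close>; the two maps that agree there
    differ at \<open>?I 4\<close>.\<close>
  have one: "\<one>\<^bsub>rd_monoid \<Z>\<^esub> (?I n) = ?I n" for n by (simp add: int.one_rd_monoid id)
  have dd: "(dualrad \<Z> [^]\<^bsub>rd_monoid \<Z>\<^esub> (2::nat)) (?I 2) = UNIV"
    by (simp add: int.dualrad_squared id d int_dualrad_zero)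
  have "\<one>\<^bsub>rd_monoid \<Z>\<^esub> \<noteq> rad \<Z>" using one[of 4] neq by metis
  moreover have "{0} \<noteq> (UNIV :: int set)" by (metis UNIV_I singletonD zero_neq_one)
  moreover have "\<one>\<^bsub>rd_monoid \<Z>\<^esub> \<noteq> dualrad \<Z>" "\<one>\<^bsub>rd_monoid \<Z>\<^esub> \<noteq> dualrad \<Z> [^]\<^bsub>rd_monoid \<Z>\<^esub> (2::nat)"
    "rad \<Z> \<noteq> dualrad \<Z>" "rad \<Z> \<noteq> dualrad \<Z> [^]\<^bsub>rd_monoid \<Z>\<^esub> (2::nat)"
    "dualrad \<Z> \<noteq> dualrad \<Z> [^]\<^bsub>rd_monoid \<Z>\<^esub> (2::nat)"
    using one[of 2] r2 d[of 2] dd neq calculation by (metis zero_neq_numeral)+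
  ultimately show ?thesis by simp
qed

theorem corollary5p2:
  shows
    \<comment> \<open>the presented monoid consists of the four distinct elements \<open>1, r, d, d\<^sup>2\<close>\<close>
    "carrier rd_presented =
       {\<one>\<^bsub>rd_presented\<^esub>, rad_gen, dual_gen, dual_gen [^]\<^bsub>rd_presented\<^esub> (2::nat)} \<and>
     distinct [\<one>\<^bsub>rd_presented\<^esub>, rad_gen, dual_gen, dual_gen [^]\<^bsub>rd_presented\<^esub> (2::nat)] \<and>
     (\<forall>R :: ('a, 'b) ring_scheme. ring R \<longrightarrow>
        (\<exists>h \<in> epi rd_presented (rd_monoid R).
           h \<one>\<^bsub>rd_presented\<^esub> = \<one>\<^bsub>rd_monoid R\<^esub> \<and> h rad_gen = rad R \<and> h dual_gen = dualrad R)) \<and>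
     (\<forall>R :: ('a, 'b) ring_scheme. ring R \<longrightarrow>
        distinct [\<one>\<^bsub>rd_monoid R\<^esub>, rad R, dualrad R, dualrad R [^]\<^bsub>rd_monoid R\<^esub> (2::nat)] \<longrightarrow>
        map_less R \<one>\<^bsub>rd_monoid R\<^esub> (rad R) \<and>
        map_less R (rad R) (dualrad R [^]\<^bsub>rd_monoid R\<^esub> (2::nat)) \<and>
        map_incomparable R (dualrad R) \<one>\<^bsub>rd_monoid R\<^esub> \<and>
        map_incomparable R (dualrad R) (rad R) \<and>
        map_incomparable R (dualrad R) (dualrad R [^]\<^bsub>rd_monoid R\<^esub> (2::nat))) \<and>
     \<comment> \<open>the largest such monoid does occur\<close>
     (\<exists>S :: int ring. ring S \<and>
        distinct [\<one>\<^bsub>rd_monoid S\<^esub>, rad S, dualrad S, dualrad S [^]\<^bsub>rd_monoid S\<^esub> (2::nat)])"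
proof (intro conjI allI impI)
  fix R :: "('a, 'b) ring_scheme"
  assume "ring R"
  then interpret ring R .
  show "\<exists>h \<in> epi rd_presented (rd_monoid R).
      h \<one>\<^bsub>rd_presented\<^esub> = \<one>\<^bsub>rd_monoid R\<^esub> \<and> h rad_gen = rad R \<and> h dual_gen = dualrad R"
    using rd_presented_epi by metis
next
  fix R :: "('a, 'b) ring_scheme"
  assume "ring R"
    and dist: "distinct [\<one>\<^bsub>rd_monoid R\<^esub>, rad R, dualrad R, dualrad R [^]\<^bsub>rd_monoid R\<^esub> (2::nat)]"
  then interpret ring R by simp
  have refl: "map_le R f f" for f by (simp add: map_le_def)
  \<comment> \<open>The composite inequality puts 1 below the square of \<open>dualrad R\<close>;
    with \<open>refl\<close>, all three elements of the chain satisfy the bounds in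
    \<open>dualrad_incomparable\<close>.\<close>
  note le = map_le_chain map_le_trans[OF map_le_chain]
  show "map_less R \<one>\<^bsub>rd_monoid R\<^esub> (rad R)"
    "map_less R (rad R) (dualrad R [^]\<^bsub>rd_monoid R\<^esub> (2::nat))"
    using dist by (simp_all add: map_less_def le)
  show "map_incomparable R (dualrad R) \<one>\<^bsub>rd_monoid R\<^esub>"
    "map_incomparable R (dualrad R) (rad R)"
    "map_incomparable R (dualrad R) (dualrad R [^]\<^bsub>rd_monoid R\<^esub> (2::nat))"
    using dist by (simp_all add: dualrad_incomparable refl le)
next
  show "\<exists>S :: int ring. ring S \<and>
      distinct [\<one>\<^bsub>rd_monoid S\<^esub>, rad S, dualrad S, dualrad S [^]\<^bsub>rd_monoid S\<^esub> (2::nat)]"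
    using int.ring_axioms int_rd_monoid_distinct by blast
qed (fact carrier_rd_presented distinct_rd_presented)+

end
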